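(* Consider the grid-aligned anisotropic diffusion equation $-u_{xx}-\epsilon u_{yy}=f$ with anisotropy ratio $\epsilon\in[0,1]$, discretized with either the finite-difference (FD) stencil or the bilinear finite-element (FE) stencil. Let $\ell\in\mathbb N$ and let $\mu_{\ell,1}(\epsilon)$ be the smoothing factor of maximally overlapping multiplicative Schwarz with $\ell\times1$ subdomains. Suppose further that the symbols $\tilde s_{\ell,1}$ of this smoother for the FD and FE discretizations are sufficiently smooth functions of $\omega_1$ and $\omega_2$. Then the smoothing factor for the FD discretization is $$\mu_{\ell,1}(\epsilon)=1-\ell(\ell+1)\,\epsilon+\mathcal O(\epsilon^2),$$ and the smoothing factor for the FE discretization is bounded from below as $$\mu_{\ell,1}(\epsilon)\ \ge\ 1-\tfrac32\,\ell(\ell+1)\,\epsilon+\mathcal O(\epsilon^2).$$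
   Context: **Stencils.** A 9-point stencil has entries $s_{nw},s_n,s_{ne},s_w,s_c,s_e,s_{sw},s_s,s_{se}$ (compass directions; $s_c$ is the center). For both discretizations below $s_{ne}=s_{sw}=s_{se}=s_{nw}$, $s_s=s_n$, $s_e=s_w$. Up to an overall positive scaling (which does not affect the symbol below): FD: $s_{nw}=0$, $s_n=-\epsilon$, $s_w=-1$, $s_c=2(1+\epsilon)$. FE: $s_{nw}=-\tfrac16-\tfrac16\epsilon$, $s_n=\tfrac13-\tfrac23\epsilon$, $s_w=-\tfrac23+\tfrac13\epsilon$, $s_c=\tfrac43+\tfrac43\epsilon$. For a frequency $(\omega_1,\omega_2)$ put $\check s_{d}=s_d\,e^{\mathrm{i}(p\,\omega_1+q\,\omega_2)}$, where $(p,q)\in\{-1,0,1\}^2$ is the grid offset of direction $d$ (east: $p=1$; west: $p=-1$; north: $q=1$; south: $q=-1$). **Smoother and its Fourier symbol.** Multiplicative Schwarz sweeps sequentially over all $\ell\times1$ blocks (one anchored at every grid point $(i,j)$, consisting of the points $(i,j),(i+1,j),\dots,(i+\ell-1,j)$ in this order), west to east and then south to north; for each block it updates the $\ell$ unknowns so that their residuals become zero. Each unknown is updated $\ell$ times per sweep. In local Fourier analysis (infinite grid), the error is a Fourier mode $e^{\mathrm{i}(\omega_1 i+\omega_2 j)}$ times an amplitude $\alpha_p$ depending on the number of times $p$ the point has been updated, and the symbol is $\tilde s_{\ell,1}(\omega_1,\omega_2)=\alpha_\ell/\alpha_0=(\mathcal A^{-1}\mathbf b)_1$ (first component), where $$\mathcal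 A=A_{ij}D(U-I)-DC,\qquad \mathbf b=D\mathbf c-A_{ij}D\mathbf e_\ell .$$ Here all matrices are $\ell\times\ell$: $D=\mathrm{diag}(1,e^{\mathrm i\omega_1},\dots,e^{\mathrm i(\ell-1)\omega_1})$; $A_{ij}$ is tridiagonal Toeplitz with subdiagonal $s_w$, diagonal $s_c$, superdiagonal $s_e$; $U-I$ has $-1$ on the diagonal and $1$ on the first superdiagonal; $C=T+(\check s_{sw}+\check s_s+\check s_{se})\mathbf 1\mathbf e_1^\top$, where $T$ is upper triangular Toeplitz with diagonal $\check s_w$, first superdiagonal $\check s_c$, second superdiagonal $\check s_e$ and zeros elsewhere; $\mathbf c=(\check s_{nw}+\check s_n+\check s_{ne})\mathbf 1+\check s_e\mathbf e_{\ell-1}+(\check s_c+\check s_e)\mathbf e_\ell$. $\mathbf e_k$ are canonical basis vectors (with $\mathbf e_0:=0$) and $\mathbf 1$ is the all-ones vector. **Smoothing factor.** $\mu=\max|\tilde s(\omega_1,\omega_2)|$ over the high frequencies $(\omega_1,\omega_2)\in[-\pi/2,3\pi/2)^2\setminus[-\pi/2,\pi/2)^2$. $\mathcal O(\cdot)$ is understood as $\epsilon\to0^+$. *)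

theory Defs
  imports
    "HOL-Analysis.Derivative"
    "HOL-Library.Landau_Symbols"
    "Jordan_Normal_Form.Gauss_Jordan_Elimination"
begin

text \<open>
  A 9-point stencil is given by its entries \<open>s p q\<close>, where \<open>(p, q) \<in> {-1, 0, 1}\<^sup>2\<close> is the grid
  offset: \<open>p\<close> counts steps to the east, \<open>q\<close> steps to the north. Only these nine values are used.
\<close>

type_synonym stencil = "int \<Rightarrow> int \<Rightarrow> real"

definition nine_point :: "real \<Rightarrow> real \<Rightarrow> real \<Rightarrow> real \<Rightarrow> stencil" where
  "nine_point s_nw s_n s_w s_c p q =
     (if p \<notin> {-1, 0, 1} \<or> q \<notin> {-1, 0, 1} then 0
      else if p = 0 \<and> q = 0 then s_c
      else if p = 0 then s_n
      else if q = 0 then s_w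
      else s_nw)"

definition fd_stencil :: "real \<Rightarrow> stencil" where
  "fd_stencil \<epsilon> = nine_point 0 (- \<epsilon>) (- 1) (2 * (1 + \<epsilon>))"

definition fe_stencil :: "real \<Rightarrow> stencil" where
  "fe_stencil \<epsilon> = nine_point (- 1 / 6 - 1 / 6 * \<epsilon>) (1 / 3 - 2 / 3 * \<epsilon>)
                            (- 2 / 3 + 1 / 3 * \<epsilon>) (4 / 3 + 4 / 3 * \<epsilon>)"

definition check_entry :: "stencil \<Rightarrow> real \<times> real \<Rightarrow> int \<Rightarrow> int \<Rightarrow> complex" where
  "check_entry s \<omega> p q = of_real (s p q) * cis (of_int p * fst \<omega> + of_int q * snd \<omega>)"

text \<open>
  The matrices of the symbol of the smoother. Rows and columns are numbered from 0, so that the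
  entry in row \<open>i\<close>, column \<open>j\<close> here has the indices \<open>i + 1\<close>, \<open>j + 1\<close> in the usual 1-based notation.
\<close>

definition phase_mat :: "nat \<Rightarrow> real \<times> real \<Rightarrow> complex mat" where
  "phase_mat l \<omega> = mat_diag l (\<lambda>i. cis (of_nat i * fst \<omega>))"

definition block_mat :: "nat \<Rightarrow> stencil \<Rightarrow> complex mat" where
  "block_mat l s = mat l l (\<lambda>(i, j).
     if i = j + 1 then of_real (s (-1) 0)
     else if i = j then of_real (s 0 0)
     else if j = i + 1 then of_real (s 1 0)
     else 0)"

definition shift_mat :: "nat \<Rightarrow> complex mat" where
  "shift_mat l = mat l l (\<lambda>(i, j). if j = i + 1 then 1 else 0)"

definition T_mat :: "nat \<Rightarrow> stencil \<Rightarrow> real \<times> real \<Rightarrow> complex mat" where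
  "T_mat l s \<omega> = mat l l (\<lambda>(i, j).
     if j = i then check_entry s \<omega> (-1) 0
     else if j = i + 1 then check_entry s \<omega> 0 0
     else if j = i + 2 then check_entry s \<omega> 1 0
     else 0)"

definition C_mat :: "nat \<Rightarrow> stencil \<Rightarrow> real \<times> real \<Rightarrow> complex mat" where
  "C_mat l s \<omega> = T_mat l s \<omega> +
     (\<Sum>p\<in>{-1, 0, 1}. check_entry s \<omega> p (-1)) \<cdot>\<^sub>m mat l l (\<lambda>(i, j). if j = 0 then 1 else 0)"

text \<open>
  The summand for \<open>i + 2 = l\<close> is the multiple of the \<open>(l - 1)\<close>-st canonical basis vector; it
  is absent if \<open>l = 1\<close>.
\<close>

definition c_vec :: "nat \<Rightarrow> stencil \<Rightarrow> real \<times> real \<Rightarrow> complex vec" where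
  "c_vec l s \<omega> = vec l (\<lambda>i.
     (\<Sum>p\<in>{-1, 0, 1}. check_entry s \<omega> p 1)
     + (if i + 2 = l then check_entry s \<omega> 1 0 else 0)
     + (if i + 1 = l then check_entry s \<omega> 0 0 + check_entry s \<omega> 1 0 else 0))"

definition sweep_mat :: "nat \<Rightarrow> stencil \<Rightarrow> real \<times> real \<Rightarrow> complex mat" where
  "sweep_mat l s \<omega> =
     block_mat l s * phase_mat l \<omega> * (shift_mat l - 1\<^sub>m l) - phase_mat l \<omega> * C_mat l s \<omega>"

definition sweep_vec :: "nat \<Rightarrow> stencil \<Rightarrow> real \<times> real \<Rightarrow> complex vec" where
  "sweep_vec l s \<omega> =
     phase_mat l \<omega> *\<^sub>v c_vec l s \<omega> - (block_mat l s * phase_mat l \<omega>) *\<^sub>v unit_vec l (l - 1)"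

definition schwarz_symbol :: "nat \<Rightarrow> stencil \<Rightarrow> real \<times> real \<Rightarrow> complex" where
  "schwarz_symbol l s \<omega> = vec_index (the (mat_inverse (sweep_mat l s \<omega>)) *\<^sub>v sweep_vec l s \<omega>) 0"

definition high_frequencies :: "(real \<times> real) set" where
  "high_frequencies =
     {- pi / 2..<3 * pi / 2} \<times> {- pi / 2..<3 * pi / 2} - {- pi / 2..<pi / 2} \<times> {- pi / 2..<pi / 2}"

text \<open>
  The set of high frequencies is not closed, but the symbol has period \<open>2 * pi\<close> in both
  frequencies and negating both conjugates it, and these symmetries map the closure of the set into
  the set itself (modulo the periods). Hence for a continuous symbol the supremum is finite and
  attained, i.e. a maximum.
\<close>

definition smoothing_factor :: "nat \<Rightarrow> stencil \<Rightarrow> real" where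
  "smoothing_factor l s = (SUP \<omega>\<in>high_frequencies. cmod (schwarz_symbol l s \<omega>))"

text \<open>\<open>k\<close> times continuously differentiable on the whole space.\<close>

primrec Ck_smooth :: "nat \<Rightarrow> ('a::real_normed_vector \<Rightarrow> 'b::real_normed_vector) \<Rightarrow> bool" where
  "Ck_smooth 0 f \<longleftrightarrow> continuous_on UNIV f"
| "Ck_smooth (Suc k) f \<longleftrightarrow>
     (\<forall>x. f differentiable (at x)) \<and> (\<forall>v. Ck_smooth k (\<lambda>x. frechet_derivative f (at x) v))"

end

theory Submission
  imports Defs "Jordan_Normal_Form.Determinant"
begin

text \<open>
  The proof rests on a closed form of the symbol. Eliminating the intermediate residuals from the
  system that defines it leaves a statement about amplitudes only: with \<open>X k\<close> the amplitude at the
  \<open>k\<close>-th point of the block right after the block update, \<open>X (- 1) = X 0\<close> (the western neighbour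
  has already received all its updates) and \<open>X l = 1\<close> (the eastern neighbour has received none), the
  residual at every point of the block vanishes. This is a constant-coefficient three-term
  recurrence whose source is the coupling to the southern and northern grid lines. Put
  \<open>a = - s_c / s_w\<close> and \<open>\<tau> = (s_n + 2 s_nw cos \<omega>\<^sub>1) / s_w\<close>, let \<open>u k\<close> solve
  \<open>u (k + 2) = a u (k + 1) - u k\<close> with \<open>u 0 = 0\<close>, \<open>u 1 = 1\<close>, and let \<open>h\<close> be the sum of
  \<open>u m exp (- i m \<omega>\<^sub>1)\<close> over \<open>m = 1, \<dots>, l\<close>. Then the symbol is
  \<open>(1 + \<tau> exp (i \<omega>\<^sub>2) h) / (1 + (a - 2 cos \<omega>\<^sub>1 - \<tau> exp (- i \<omega>\<^sub>2)) h)\<close>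
  (\<open>schwarz_symbol_nine_point\<close>).

  Numerator \<open>N\<close> and denominator \<open>D\<close> satisfy the exact identity
  \<open>|D|\<^sup>2 = |N|\<^sup>2 + (a - 2 cos \<omega>\<^sub>1 - 2 \<tau> cos \<omega>\<^sub>2) u l u (l + 1)\<close>
  (\<open>symbol_den_norm_identity\<close>), in which the bracket is the Fourier symbol of the discrete operator
  divided by \<open>- s_w\<close>.

  For finite differences \<open>a = 2 + 2 \<epsilon>\<close> and \<open>\<tau> = \<epsilon>\<close>. On the high frequencies the bracket is at
  least \<open>2 \<epsilon>\<close>, while \<open>u l u (l + 1) \<ge> l (l + 1)\<close> and \<open>|N| = 1 + O(\<epsilon>)\<close>. So the squared modulus
  of the symbol is at most \<open>1 - 2 l (l + 1) \<epsilon> + O(\<epsilon>\<^sup>2)\<close> uniformly in the frequency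
  (\<open>fd_symbol_upper\<close>). Conversely, at the high frequency \<open>(0, \<pi> / 2)\<close> the modulus is at least
  \<open>1 - 2 \<epsilon> h\<close>, where \<open>2 h = l (l + 1) + O(\<epsilon>)\<close> (\<open>nine_point_symbol_lower\<close>).

  On the line \<open>\<omega>\<^sub>1 = 0\<close> the closed form depends only on \<open>a\<close> and \<open>(s_n + 2 s_nw) / s_w\<close>. For finite
  elements with ratio \<open>\<epsilon>\<close> these agree with the finite difference values for the ratio
  \<open>3 \<epsilon> / (2 - \<epsilon>) = 3 / 2 \<epsilon> + O(\<epsilon>\<^sup>2)\<close>. Hence the same test frequency gives the lower bound with the
  factor \<open>3 / 2\<close>. Continuity of the symbol bounds its moduli over the high frequencies, so that their
  supremum dominates the value at the test frequency.
\<close>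

section \<open>Homogeneous solutions and discrete Green sums\<close>

text \<open>
  These are the values of the Chebyshev polynomials of the second kind, \<open>U\<^bsub>k - 1\<^esub>(a / 2)\<close>, with the
  index shifted so that they solve the initial value problem \<open>0, 1, \<dots>\<close>.
\<close>

fun cheb :: "real \<Rightarrow> nat \<Rightarrow> real" where
  "cheb a 0 = 0"
| "cheb a (Suc 0) = 1"
| "cheb a (Suc (Suc k)) = a * cheb a (Suc k) - cheb a k"

text \<open>
  Up to sign, the response of the recurrence with zero initial data to a unit source with phase
  \<open>exp (i k \<theta>)\<close>, taken relative to that phase.
\<close>

definition green_sum :: "nat \<Rightarrow> real \<Rightarrow> real \<Rightarrow> complex" where
  "green_sum l a \<theta> = (\<Sum>m=1..l. of_real (cheb a m) * cis (- \<theta>) ^ m)"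

lemma green_sum_0 [simp]: "green_sum 0 a \<theta> = 0"
  by (simp add: green_sum_def)

lemma green_sum_Suc:
  "green_sum (Suc l) a \<theta> = green_sum l a \<theta> + of_real (cheb a (Suc l)) * cis (- \<theta>) ^ Suc l"
  by (simp add: green_sum_def)

text \<open>
  Multiplying the partial sums by \<open>a exp (- i \<theta>)\<close> and applying the recursion of \<open>cheb\<close> termwise shifts
  every term by one index. Thus the Green sums solve the same recurrence as the amplitudes, with a
  constant source.
\<close>

lemma green_sum_step:
  "green_sum (Suc (Suc l)) a \<theta> =
     of_real a * cis (- \<theta>) * green_sum (Suc l) a \<theta> - cis (- \<theta>) ^ 2 * green_sum l a \<theta> + cis (- \<theta>)"
proof (induction l)
  case 0
  then show ?case by (simp add: green_sum_Suc power2_eq_square)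
next
  case (Suc l)
  define w where "w = cis (- \<theta>)"
  have "green_sum (Suc (Suc (Suc l))) a \<theta> =
      green_sum (Suc (Suc l)) a \<theta> + of_real (cheb a (Suc (Suc (Suc l)))) * w ^ Suc (Suc (Suc l))"
    unfolding w_def by (rule green_sum_Suc)
  also have "\<dots> = of_real a * w * (green_sum (Suc l) a \<theta> + of_real (cheb a (Suc (Suc l))) * w ^ Suc (Suc l))
      - w ^ 2 * (green_sum l a \<theta> + of_real (cheb a (Suc l)) * w ^ Suc l) + w"
    unfolding Suc by (simp add: w_def power2_eq_square algebra_simps)
  finally show ?case
    unfolding w_def green_sum_Suc[symmetric] .
qed

text \<open>
  A plane wave is an eigenvector of the three-term operator, with eigenvalue \<open>a - 2 cos \<theta>\<close> up to sign,
  so the eigenvalue times the Green sum telescopes to boundary terms.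
\<close>

lemma green_sum_resolvent:
  "1 + of_real (a - 2 * cos \<theta>) * green_sum l a \<theta> =
     cis (- \<theta>) ^ l * of_real (cheb a (Suc l)) - cis (- \<theta>) ^ Suc l * of_real (cheb a l)"
proof (induction l)
  case (Suc l)
  define w where "w = cis (- \<theta>)"
  have w: "of_real (2 * cos \<theta>) = w + cis \<theta>" "cis \<theta> * w = 1"
    by (auto simp: w_def complex_eq_iff cis_mult)
  have "1 + of_real (a - 2 * cos \<theta>) * green_sum (Suc l) a \<theta> =
      w ^ l * of_real (cheb a (Suc l)) - w ^ Suc l * of_real (cheb a l)
      + of_real (a - 2 * cos \<theta>) * (of_real (cheb a (Suc l)) * w ^ Suc l)"
    using Suc by (simp add: green_sum_Suc w_def algebra_simps)
  also have "\<dots> = w ^ Suc l * (a * cheb a (Suc l)) - w ^ Suc l * cheb a l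
       - w ^ Suc (Suc l) * cheb a (Suc l) + w ^ l * cheb a (Suc l) * (1 - cis \<theta> * w)"
    by (simp only: of_real_diff w(1)) (simp add: algebra_simps)
  finally show ?case
    by (simp add: w(2)) (simp add: w_def algebra_simps)
qed simp

text \<open>
  This quadratic form in the Green sum arises when numerator and denominator of the symbol are
  compared. It telescopes in \<open>l\<close>: the increment pairs the new summand with \<open>1 + (a - 2 cos \<theta>) h\<close>,
  and by the resolvent identity that pairing is \<open>u cos \<theta>\<close> minus the previous Chebyshev value.
\<close>

lemma green_sum_energy:
  "2 * Re (green_sum l a \<theta>) + (a - 2 * cos \<theta>) * (cmod (green_sum l a \<theta>))\<^sup>2 = cheb a l * cheb a (Suc l)"
proof (induction l)
  case (Suc l)
  define h where "h = green_sum l a \<theta>"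
  define w where "w = cis (- \<theta>)"
  define \<sigma> where "\<sigma> = a - 2 * cos \<theta>"
  define u where "u = cheb a (Suc l)"
  have one: "w ^ k * cnj (w ^ k) = 1" for k
    by (subst complex_norm_square[symmetric]) (simp add: w_def norm_power)
  have cw: "w * w ^ l * cnj (w ^ l) = w"
    using one[of l] by (simp add: mult.assoc)
  have "w ^ Suc l * cnj (1 + of_real \<sigma> * h) =
      of_real u * (w * w ^ l * cnj (w ^ l)) - of_real (cheb a l) * (w ^ Suc l * cnj (w ^ Suc l))"
    unfolding h_def \<sigma>_def green_sum_resolvent by (simp add: u_def w_def algebra_simps)
  also have "\<dots> = of_real u * w - of_real (cheb a l)"
    by (simp only: cw one) simp
  finally have cross: "Re (w ^ Suc l * cnj (1 + of_real \<sigma> * h)) = u * cos \<theta> - cheb a l"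
    by (simp add: w_def)
  have nw: "cmod (w ^ Suc l) = 1"
    by (simp add: w_def norm_power norm_mult)
  have sq: "(cmod (h + of_real u * W))\<^sup>2 = (cmod h)\<^sup>2 + 2 * u * Re (W * cnj h) + u\<^sup>2 * (cmod W)\<^sup>2" for W
    unfolding cmod_power2 by (simp add: power2_eq_square algebra_simps)
  have cr2: "Re (W * cnj (1 + of_real \<sigma> * h)) = Re W + \<sigma> * Re (W * cnj h)" for W
    by (simp add: algebra_simps)
  have "2 * Re (h + of_real u * w ^ Suc l) + \<sigma> * (cmod (h + of_real u * w ^ Suc l))\<^sup>2
     = 2 * Re h + \<sigma> * (cmod h)\<^sup>2 + u * (2 * Re (w ^ Suc l * cnj (1 + of_real \<sigma> * h)) + \<sigma> * u)"
    unfolding sq nw cr2 by (simp add: algebra_simps power2_eq_square)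
  also have "\<dots> = cheb a l * u + u * (2 * (u * cos \<theta> - cheb a l) + \<sigma> * u)"
    unfolding cross using Suc by (simp add: h_def \<sigma>_def u_def)
  also have "\<dots> = u * (a * u - cheb a l)"
    by (simp add: \<sigma>_def algebra_simps)
  finally show ?case
    by (simp add: green_sum_Suc h_def w_def \<sigma>_def u_def)
qed simp

text \<open>
  The terms linear in \<open>Im h\<close> and those with \<open>\<tau>\<^sup>2\<close> cancel between the two sides, because \<open>\<tau>\<close> is real and occurs
  with conjugate phases. What remains factors.
\<close>

lemma cmod_symbol_energy:
  fixes h :: complex
  shows "(cmod (1 + (of_real \<sigma> - of_real \<tau> * cis (- \<phi>)) * h))\<^sup>2 =
     (cmod (1 + of_real \<tau> * cis \<phi> * h))\<^sup>2
      + (\<sigma> - 2 * \<tau> * cos \<phi>) * (2 * Re h + \<sigma> * (cmod h)\<^sup>2)"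
  unfolding cmod_power2 by (simp add: power2_eq_square algebra_simps)

section \<open>The residual equations of a block update\<close>

lemma sum_delta_lessThan:
  fixes f :: "nat \<Rightarrow> 'a :: comm_monoid_add"
  shows "(\<Sum>j = 0..<l. if j = k then f j else 0) = (if k < l then f k else 0)"
  by (subst sum.delta) auto

lemma block_mat_mult_index:
  assumes "i < l"
  shows "vec_index (block_mat l s *\<^sub>v vec l v) i =
    (if i \<ge> 1 then of_real (s (-1) 0) * v (i - 1) else 0) + of_real (s 0 0) * v i
     + (if i + 1 < l then of_real (s 1 0) * v (i + 1) else 0)"
proof -
  have "vec_index (block_mat l s *\<^sub>v vec l v) i =
     (\<Sum>j = 0..<l. (if j = i - 1 then (if i \<ge> 1 then of_real (s (-1) 0) * v j else 0) else 0)
       + (if j = i then of_real (s 0 0) * v j else 0)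
       + (if j = i + 1 then of_real (s 1 0) * v j else 0))"
    using assms by (auto simp: block_mat_def scalar_prod_def intro!: sum.cong)
  also have "\<dots> = (if i \<ge> 1 then of_real (s (-1) 0) * v (i - 1) else 0) + of_real (s 0 0) * v i
     + (if i + 1 < l then of_real (s 1 0) * v (i + 1) else 0)"
    using assms unfolding sum.distrib sum_delta_lessThan by auto
  finally show ?thesis .
qed

lemma phase_mat_mult: "phase_mat l \<omega> *\<^sub>v vec l v = vec l (\<lambda>i. cis (of_nat i * fst \<omega>) * v i)"
proof (rule eq_vecI)
  fix i assume i: "i < dim_vec (vec l (\<lambda>i. cis (of_nat i * fst \<omega>) * v i))"
  then have "vec_index (phase_mat l \<omega> *\<^sub>v vec l v) i =
     (\<Sum>j = 0..<l. if j = i then cis (of_nat j * fst \<omega>) * v j else 0)"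
    by (auto simp: phase_mat_def mat_diag_def scalar_prod_def
        simp del: sum.delta sum.delta' intro!: sum.cong)
  then show "vec_index (phase_mat l \<omega> *\<^sub>v vec l v) i = vec_index (vec l (\<lambda>i. cis (of_nat i * fst \<omega>) * v i)) i"
    using i by (simp add: sum_delta_lessThan)
qed (simp add: phase_mat_def mat_diag_def)

lemma shift_mat_mult:
  "(shift_mat l - 1\<^sub>m l) *\<^sub>v vec l v = vec l (\<lambda>i. (if i + 1 < l then v (i + 1) else 0) - v i)"
proof (rule eq_vecI)
  fix i assume i: "i < dim_vec (vec l (\<lambda>i. (if i + 1 < l then v (i + 1) else 0) - v i))"
  then have "vec_index ((shift_mat l - 1\<^sub>m l) *\<^sub>v vec l v) i =
     (\<Sum>j = 0..<l. (if j = i + 1 then v j else 0) - (if j = i then v j else 0))"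
    by (auto simp: shift_mat_def scalar_prod_def intro!: sum.cong)
  then show "vec_index ((shift_mat l - 1\<^sub>m l) *\<^sub>v vec l v) i =
      vec_index (vec l (\<lambda>i. (if i + 1 < l then v (i + 1) else 0) - v i)) i"
    using i by (simp add: sum_delta_lessThan sum_subtractf)
qed (simp add: shift_mat_def)

lemma C_mat_mult:
  "C_mat l s \<omega> *\<^sub>v vec l v = vec l (\<lambda>i. check_entry s \<omega> (-1) 0 * v i
      + (if i + 1 < l then check_entry s \<omega> 0 0 * v (i + 1) else 0)
      + (if i + 2 < l then check_entry s \<omega> 1 0 * v (i + 2) else 0)
      + (\<Sum>p\<in>{-1, 0, 1}. check_entry s \<omega> p (-1)) * v 0)" (is "_ = vec l ?r")
proof (rule eq_vecI)
  fix i assume i: "i < dim_vec (vec l ?r)"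
  define S where "S = (\<Sum>p\<in>{-1, 0, 1}. check_entry s \<omega> p (-1))"
  have "vec_index (C_mat l s \<omega> *\<^sub>v vec l v) i =
     (\<Sum>j = 0..<l. (if j = i then check_entry s \<omega> (-1) 0 * v j else 0)
        + (if j = i + 1 then check_entry s \<omega> 0 0 * v j else 0)
        + (if j = i + 2 then check_entry s \<omega> 1 0 * v j else 0)
        + (if j = 0 then S * v j else 0))"
    using i by (auto simp: C_mat_def T_mat_def scalar_prod_def S_def[symmetric] ring_distribs
        intro!: sum.cong)
  also have "\<dots> = ?r i"
    using i unfolding sum.distrib sum_delta_lessThan S_def by auto
  finally show "vec_index (C_mat l s \<omega> *\<^sub>v vec l v) i = vec_index (vec l ?r) i"
    using i by simp
qed (simp add: C_mat_def T_mat_def)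


text \<open>
  The matrix and vector of the symbol encode: stencil applied to the update of the block equals the
  residual before the update. Moving everything to one side leaves the residual after the update,
  with the amplitudes \<open>X 0, \<dots>, X (l - 1)\<close> inside the block and \<open>X l\<close> east and north of it. The
  southern grid line carries \<open>X 0\<close>, and so does the western neighbour of the block; the latter is
  expressed by the truncated subtraction, since \<open>X (i - 1)\<close> means \<open>X 0\<close> for \<open>i = 0\<close>. Keeping the
  factor \<open>X l\<close> lets one identity serve both the inhomogeneous system (\<open>X l = 1\<close>) and its kernel
  (\<open>X l = 0\<close>).
\<close>

lemma sweep_residual_row:
  assumes "i < l"
  shows "vec_index (sweep_mat l s \<omega> *\<^sub>v vec l X) i - X l * vec_index (sweep_vec l s \<omega>) i =
     - cis (of_nat i * fst \<omega>) *
       (check_entry s \<omega> (-1) 0 * X (i - 1) + check_entry s \<omega> 0 0 * X i + check_entry s \<omega> 1 0 * X (i + 1)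
        + (\<Sum>p\<in>{-1, 0, 1}. check_entry s \<omega> p (-1)) * X 0 + (\<Sum>p\<in>{-1, 0, 1}. check_entry s \<omega> p 1) * X l)"
proof -
  define z where "z = cis (fst \<omega>)"
  define S where "S = (\<Sum>p\<in>{-1, 0, 1}. check_entry s \<omega> p (-1))"
  define N where "N = (\<Sum>p\<in>{-1, 0, 1}. check_entry s \<omega> p 1)"
  have z0: "z \<noteq> 0" and zp: "cis (of_nat j * fst \<omega>) = z ^ j" for j
    by (simp_all add: z_def DeMoivre)
  have chk: "check_entry s \<omega> (-1) 0 = of_real (s (-1) 0) / z"
    "check_entry s \<omega> 0 0 = of_real (s 0 0)" "check_entry s \<omega> 1 0 = of_real (s 1 0) * z"
    by (simp_all add: check_entry_def z_def cis_inverse[symmetric] field_simps)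
  have carr: "block_mat l s \<in> carrier_mat l l" "phase_mat l \<omega> \<in> carrier_mat l l"
    "shift_mat l - 1\<^sub>m l \<in> carrier_mat l l" "C_mat l s \<omega> \<in> carrier_mat l l" "vec l X \<in> carrier_vec l"
    by (auto simp: block_mat_def phase_mat_def shift_mat_def C_mat_def T_mat_def)
  have "sweep_mat l s \<omega> *\<^sub>v vec l X =
      block_mat l s *\<^sub>v (phase_mat l \<omega> *\<^sub>v ((shift_mat l - 1\<^sub>m l) *\<^sub>v vec l X))
      - phase_mat l \<omega> *\<^sub>v (C_mat l s \<omega> *\<^sub>v vec l X)"
    unfolding sweep_mat_def using carr
    by (subst minus_mult_distrib_mat_vec[where nr = l and nc = l])
       (auto simp: assoc_mult_mat_vec[where ?n\<^sub>1 = l and ?n\<^sub>2 = l and ?n\<^sub>3 = l])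
  then have mat_row: "vec_index (sweep_mat l s \<omega> *\<^sub>v vec l X) i =
     (if i \<ge> 1 then of_real (s (-1) 0) * (z ^ (i - 1) * (X i - X (i - 1))) else 0)
     + of_real (s 0 0) * (z ^ i * ((if i + 1 < l then X (i + 1) else 0) - X i))
     + (if i + 1 < l then of_real (s 1 0) * (z ^ (i + 1) * ((if i + 2 < l then X (i + 2) else 0) - X (i + 1))) else 0)
     - z ^ i * (of_real (s (-1) 0) / z * X i
        + (if i + 1 < l then of_real (s 0 0) * X (i + 1) else 0)
        + (if i + 2 < l then of_real (s 1 0) * z * X (i + 2) else 0) + S * X 0)"
    unfolding C_mat_mult shift_mat_mult phase_mat_mult using \<open>i < l\<close>
    by (auto simp: block_mat_mult_index[OF \<open>i < l\<close>] zp chk S_def dest: carrier_matD)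
  have unit: "unit_vec l (l - 1) = vec l (\<lambda>i. if i + 1 = l then 1 else 0 :: complex)"
    using \<open>i < l\<close> by (intro eq_vecI) auto
  have "sweep_vec l s \<omega> = phase_mat l \<omega> *\<^sub>v c_vec l s \<omega>
      - block_mat l s *\<^sub>v (phase_mat l \<omega> *\<^sub>v unit_vec l (l - 1))"
    unfolding sweep_vec_def using carr
    by (simp add: assoc_mult_mat_vec[where ?n\<^sub>1 = l and ?n\<^sub>2 = l and ?n\<^sub>3 = l])
  then have vec_row: "vec_index (sweep_vec l s \<omega>) i =
      z ^ i * (N + (if i + 2 = l then of_real (s 1 0) * z else 0)
         + (if i + 1 = l then of_real (s 0 0) + of_real (s 1 0) * z else 0))
      - (of_real (s 0 0) * (z ^ i * (if i + 1 = l then 1 else 0))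
        + (if i + 1 < l then of_real (s 1 0) * (z ^ (i + 1) * (if i + 2 = l then 1 else 0)) else 0))"
    unfolding unit c_vec_def phase_mat_mult using \<open>i < l\<close>
    by (auto simp: block_mat_mult_index[OF \<open>i < l\<close>] zp chk N_def carrier_matD[OF carr(1)])
  have west_term: "(if i \<ge> 1 then of_real (s (-1) 0) * (z ^ (i - 1) * (X i - X (i - 1))) else 0) =
      z ^ i * (of_real (s (-1) 0) / z * (X i - X (i - 1)))"
    using z0 by (cases i) auto
  \<comment> \<open>The last two rows differ, because there the tridiagonal matrices and \<open>C\<close> are cut off; the entries
     of \<open>c\<close> and of the unit vector supply precisely the missing terms.\<close>
  consider "i + 1 = l" | "i + 2 = l" | "i + 2 < l"
    using \<open>i < l\<close> by linarith
  then show ?thesis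
    unfolding mat_row vec_row west_term zp chk S_def[symmetric] N_def[symmetric]
    by cases (auto simp: algebra_simps)
qed

text \<open>
  With \<open>X (- 1) = X 0\<close> the initial data select a solution that is constant up to a multiple of the
  Green sum. The multiple is minus the residual of the constant, since constant amplitudes form a plane
  wave.
\<close>

lemma block_recurrence_solution:
  fixes X :: "nat \<Rightarrow> complex" and t :: complex
  assumes "\<And>i. i < l \<Longrightarrow>
      cis (- \<theta>) * X (i - 1) - of_real a * X i + cis \<theta> * X (i + 1) + t = 0"
    and "k \<le> l"
  shows "X k = X 0 + green_sum k a \<theta> * (of_real (a - 2 * cos \<theta>) * X 0 - t)"
proof -
  define w where "w = cis (- \<theta>)"
  have w: "w * cis \<theta> = 1" "of_real (2 * cos \<theta>) = w + cis \<theta>"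
    by (auto simp: w_def complex_eq_iff cis_mult)
  have w2: "w ^ 2 = of_real (2 * cos \<theta>) * w - 1"
    using w by (simp add: algebra_simps power2_eq_square)
  have step: "X (i + 1) = of_real a * w * X i - w ^ 2 * X (i - 1) - w * t" if "i < l" for i
  proof -
    have "X (i + 1) = w * (cis \<theta> * X (i + 1))"
      using w by (simp add: mult.assoc[symmetric])
    also have "cis \<theta> * X (i + 1) = of_real a * X i - w * X (i - 1) - t"
    proof -
      have "p - q + r + t = 0 \<Longrightarrow> r = q - p - t" for p q r :: complex
        by (drule add_eq_0_iff[THEN iffD1]) simp
      then show ?thesis using assms(1)[OF that] unfolding w_def .
    qed
    finally show ?thesis by (simp add: algebra_simps power2_eq_square)
  qed
  define d where "d = of_real (a - 2 * cos \<theta>) * X 0 - t"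
  have shift: "of_real a * w * X 0 - w ^ 2 * X 0 - w * t = X 0 + w * d"
    unfolding w2 d_def of_real_diff by (simp add: algebra_simps)
  show ?thesis
    unfolding d_def[symmetric] using \<open>k \<le> l\<close>
  proof (induction k rule: induct_nat_012)
    case 1
    then show ?case using step[of 0] shift by (auto simp: green_sum_Suc w_def)
  next
    case (ge2 k)
    then have "X (Suc (Suc k)) = of_real a * w * (X 0 + green_sum (Suc k) a \<theta> * d)
          - w ^ 2 * (X 0 + green_sum k a \<theta> * d) - w * t"
        using step[of "Suc k"] by simp
      also have "\<dots> = (of_real a * w * X 0 - w ^ 2 * X 0 - w * t)
         + (of_real a * w * green_sum (Suc k) a \<theta> - w ^ 2 * green_sum k a \<theta>) * d"
        by (simp add: algebra_simps)
      also have "\<dots> = X 0 + green_sum (Suc (Suc k)) a \<theta> * d"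
        unfolding shift unfolding green_sum_step w_def by (simp add: algebra_simps)
      finally show ?case .
  qed simp
qed


section \<open>The closed form of the symbol\<close>

definition symbol_num :: "nat \<Rightarrow> real \<Rightarrow> real \<Rightarrow> real \<times> real \<Rightarrow> complex" where
  "symbol_num l a \<tau> \<omega> = 1 + of_real \<tau> * cis (snd \<omega>) * green_sum l a (fst \<omega>)"

definition symbol_den :: "nat \<Rightarrow> real \<Rightarrow> real \<Rightarrow> real \<times> real \<Rightarrow> complex" where
  "symbol_den l a \<tau> \<omega> =
     1 + (of_real (a - 2 * cos (fst \<omega>)) - of_real \<tau> * cis (- snd \<omega>)) * green_sum l a (fst \<omega>)"

text \<open>
  By the east-west symmetry of the stencil the three couplings to a neighbouring grid line add up to
  a real multiple of a single phase in \<open>\<omega>\<^sub>2\<close>. The southern and the northern multiple are equal,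
  which makes \<open>\<tau>\<close> the only parameter of the coupling.
\<close>

lemma nine_point_row:
  assumes "s_w \<noteq> 0" "s = nine_point s_nw s_n s_w s_c"
    and "\<tau> = (s_n + 2 * s_nw * cos (fst \<omega>)) / s_w"
  shows "check_entry s \<omega> (-1) 0 * x + check_entry s \<omega> 0 0 * y + check_entry s \<omega> 1 0 * z
        + (\<Sum>p\<in>{-1, 0, 1}. check_entry s \<omega> p (-1)) * u + (\<Sum>p\<in>{-1, 0, 1}. check_entry s \<omega> p 1) * v =
    of_real s_w * (cis (- fst \<omega>) * x - of_real (- s_c / s_w) * y + cis (fst \<omega>) * z
      + of_real \<tau> * (cis (- snd \<omega>) * u + cis (snd \<omega>) * v))"
proof -
  have sum_cis: "(\<Sum>p\<in>{-1, 0, 1}. check_entry s \<omega> p q) =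
      of_real (s_n + 2 * s_nw * cos (fst \<omega>)) * cis (of_int q * snd \<omega>)" if "q \<in> {-1, 1}" for q
    using that assms
    by (auto simp: check_entry_def nine_point_def complex_eq_iff cos_add sin_add cos_diff sin_diff algebra_simps)
  have \<tau>: "s_n + 2 * s_nw * cos (fst \<omega>) = s_w * \<tau>"
    using assms by simp
  have entries: "check_entry s \<omega> (-1) 0 = of_real s_w * cis (- fst \<omega>)"
    "check_entry s \<omega> 0 0 = - (of_real s_w * of_real (- s_c / s_w))"
    "check_entry s \<omega> 1 0 = of_real s_w * cis (fst \<omega>)"
    using assms by (simp_all add: check_entry_def nine_point_def)
  have sums: "(\<Sum>p\<in>{-1, 0, 1}. check_entry s \<omega> p (-1)) = of_real s_w * of_real \<tau> * cis (- snd \<omega>)"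
    "(\<Sum>p\<in>{-1, 0, 1}. check_entry s \<omega> p 1) = of_real s_w * of_real \<tau> * cis (snd \<omega>)"
    by (simp_all only: sum_cis[of "-1"] sum_cis[of 1] insert_iff simp_thms \<tau>) simp_all
  have "p * a * x + - (p * g) * y + p * b * z + p * q * e * u + p * q * f * v =
      p * (a * x - g * y + b * z + q * (e * u + f * v))" for p q a b e f g :: complex
    by (simp add: algebra_simps)
  then show ?thesis
    unfolding entries sums .
qed

text \<open>
  Closing the recurrence at \<open>k = l\<close> gives one scalar equation for \<open>X 0\<close>, and \<open>X 0\<close> together with \<open>X l\<close>
  determines all other amplitudes.
\<close>

lemma sweep_system_solution:
  fixes X :: "nat \<Rightarrow> complex"
  assumes "s_w \<noteq> 0" and s: "s = nine_point s_nw s_n s_w s_c" and a: "a = - s_c / s_w"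
    and \<tau>: "\<tau> = (s_n + 2 * s_nw * cos (fst \<omega>)) / s_w"
    and rows: "\<And>i. i < l \<Longrightarrow> vec_index (sweep_mat l s \<omega> *\<^sub>v vec l X) i = X l * vec_index (sweep_vec l s \<omega>) i"
  shows "symbol_den l a \<tau> \<omega> * X 0 = symbol_num l a \<tau> \<omega> * X l"
    and "k \<le> l \<Longrightarrow> X 0 = 0 \<Longrightarrow> X l = 0 \<Longrightarrow> X k = 0"
proof -
  define t where "t = of_real \<tau> * (cis (- snd \<omega>) * X 0 + cis (snd \<omega>) * X l)"
  have "cis (- fst \<omega>) * X (i - 1) - of_real a * X i + cis (fst \<omega>) * X (i + 1) + t = 0" if "i < l" for i
  proof -
    have cancel: "0 = - cis x * (of_real s_w * E) \<Longrightarrow> E = 0" for x E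
      using \<open>s_w \<noteq> 0\<close> by simp
    show ?thesis
      unfolding t_def a
      by (rule cancel, rule sweep_residual_row[OF that, of s \<omega> X,
            unfolded rows[OF that] diff_self nine_point_row[OF \<open>s_w \<noteq> 0\<close> s \<tau>]])
  qed
  note sol = block_recurrence_solution[of l "fst \<omega>" X a t, OF this]
  have "symbol_den l a \<tau> \<omega> * X 0 - symbol_num l a \<tau> \<omega> * X l =
      X 0 + green_sum l a (fst \<omega>) * (of_real (a - 2 * cos (fst \<omega>)) * X 0 - t) - X l"
    unfolding symbol_den_def symbol_num_def t_def by (simp add: algebra_simps)
  also have "\<dots> = 0"
    unfolding right_minus_eq by (rule sol[OF _ order_refl, symmetric])
  finally show "symbol_den l a \<tau> \<omega> * X 0 = symbol_num l a \<tau> \<omega> * X l"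
    by simp
  show "k \<le> l \<Longrightarrow> X 0 = 0 \<Longrightarrow> X l = 0 \<Longrightarrow> X k = 0"
    by (subst sol) (simp_all add: t_def)
qed

text \<open>
  By the previous lemma with \<open>X l = 0\<close> the system has a trivial kernel when the denominator does not
  vanish, so the inverse in the definition of the symbol exists; with \<open>X l = 1\<close> the scalar equation
  then yields the first component of the solution.
\<close>

lemma schwarz_symbol_nine_point:
  assumes "l \<ge> 1" "s_w \<noteq> 0" and s: "s = nine_point s_nw s_n s_w s_c" and a: "a = - s_c / s_w"
    and \<tau>: "\<tau> = (s_n + 2 * s_nw * cos (fst \<omega>)) / s_w"
    and den: "symbol_den l a \<tau> \<omega> \<noteq> 0"
  shows "schwarz_symbol l s \<omega> = symbol_num l a \<tau> \<omega> / symbol_den l a \<tau> \<omega>"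
proof -
  let ?A = "sweep_mat l s \<omega>" and ?b = "sweep_vec l s \<omega>"
  have A: "?A \<in> carrier_mat l l"
    by (auto simp: sweep_mat_def block_mat_def phase_mat_def mat_diag_def C_mat_def T_mat_def)
  have b: "?b \<in> carrier_vec l"
    by (rule carrier_vecI) (simp add: sweep_vec_def block_mat_def)
  note sol = sweep_system_solution[OF \<open>s_w \<noteq> 0\<close> s a \<tau>]
  have "det ?A \<noteq> 0"
  proof
    assume "det ?A = 0"
    then obtain v where v: "v \<in> carrier_vec l" "v \<noteq> 0\<^sub>v l" "?A *\<^sub>v v = 0\<^sub>v l"
      using det_0_iff_vec_prod_zero[OF A] by auto
    define X where "X = (\<lambda>i. if i < l then vec_index v i else 0)"
    have vX: "vec l X = v" "X l = 0"
      using v(1) by (auto simp: X_def)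
    have rows: "vec_index (?A *\<^sub>v vec l X) i = X l * vec_index ?b i" if "i < l" for i
      unfolding vX v(3) using that by simp
    have "X 0 = 0"
      using sol(1)[of l X] rows vX den by simp
    then have "X k = 0" if "k \<le> l" for k
      using sol(2)[of l X k] rows vX that by simp
    then have "v = 0\<^sub>v l"
      unfolding vX(1)[symmetric] by (intro eq_vecI) auto
    with v(2) show False by simp
  qed
  then have "?A \<in> Units (ring_mat TYPE(complex) l ())"
    by (rule det_non_zero_imp_unit[OF A])
  then obtain B where B: "mat_inverse ?A = Some B"
    using mat_inverse(1)[OF A, of "()"] by (cases "mat_inverse ?A") auto
  then have AB: "?A * B = 1\<^sub>m l" and Bc: "B \<in> carrier_mat l l"
    using mat_inverse(2)[OF A B] by auto
  define X where "X = (\<lambda>i. if i < l then vec_index (B *\<^sub>v ?b) i else 1)"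
  have Xv: "vec l X = B *\<^sub>v ?b" "X l = 1"
    using Bc b by (auto simp: X_def)
  have "?A *\<^sub>v (B *\<^sub>v ?b) = ?b"
    using assoc_mult_mat_vec[OF A Bc b] AB b by simp
  then have "symbol_den l a \<tau> \<omega> * X 0 = symbol_num l a \<tau> \<omega>"
    using sol(1)[of l X] Xv by simp
  moreover have "schwarz_symbol l s \<omega> = X 0"
    using B \<open>l \<ge> 1\<close> by (simp add: schwarz_symbol_def X_def)
  ultimately show ?thesis
    using den by (simp add: field_simps)
qed

text \<open>
  The factor in front of the Chebyshev values is the Fourier symbol of the discrete operator, divided
  by \<open>- s_w\<close>. Its positivity therefore means both that the symbol is well defined and that its
  modulus is below one when the Chebyshev values are positive.
\<close>

lemma symbol_den_norm_identity:
  "(cmod (symbol_den l a \<tau> \<omega>))\<^sup>2 = (cmod (symbol_num l a \<tau> \<omega>))\<^sup>2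
     + (a - 2 * cos (fst \<omega>) - 2 * \<tau> * cos (snd \<omega>)) * (cheb a l * cheb a (Suc l))"
  unfolding symbol_den_def symbol_num_def cmod_symbol_energy green_sum_energy ..

section \<open>Chebyshev values near the degenerate case\<close>

text \<open>
  For \<open>a = 2\<close> the recurrence is solved by \<open>k\<close> itself; for larger \<open>a\<close> the solution is convex and
  grows faster.
\<close>

lemma cheb_increasing:
  assumes "a \<ge> 2"
  shows "cheb a (Suc k) \<ge> cheb a k + 1 \<and> cheb a k \<ge> real k"
proof (induction k)
  case (Suc k)
  then have "2 * cheb a (Suc k) \<le> a * cheb a (Suc k)"
    using assms by (intro mult_right_mono) auto
  moreover have "cheb a (Suc (Suc k)) = a * cheb a (Suc k) - cheb a k"
    by simp
  ultimately show ?case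
    using Suc by linarith
qed simp

lemmas cheb_ge_index = cheb_increasing[THEN conjunct2]

lemma cheb_le_index_plus:
  "\<exists>K\<ge>0. \<forall>\<epsilon>\<in>{0..1}. cheb (2 + 2 * \<epsilon>) k \<le> real k + K * \<epsilon>"
proof (induction k rule: induct_nat_012)
  case (ge2 k)
  then obtain K where K: "K \<ge> 0" "\<And>\<epsilon>. \<epsilon> \<in> {0..1} \<Longrightarrow> cheb (2 + 2 * \<epsilon>) (Suc k) \<le> real (Suc k) + K * \<epsilon>"
    by blast
  show ?case
  proof (intro exI[of _ "4 * K + 2 * real (Suc k)"] conjI ballI)
    fix \<epsilon> :: real assume \<epsilon>: "\<epsilon> \<in> {0..1}"
    have "2 * \<epsilon> * cheb (2 + 2 * \<epsilon>) (Suc k) \<le> 2 * \<epsilon> * (real (Suc k) + K * \<epsilon>)"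
      using \<epsilon> by (intro mult_left_mono K) auto
    moreover have "K * \<epsilon> * \<epsilon> \<le> K * \<epsilon> * 1"
      using \<epsilon> K(1) by (intro mult_left_mono) auto
    ultimately show "cheb (2 + 2 * \<epsilon>) (Suc (Suc k)) \<le> real (Suc (Suc k)) + (4 * K + 2 * real (Suc k)) * \<epsilon>"
      using K(2)[OF \<epsilon>] cheb_ge_index[of "2 + 2 * \<epsilon>" k] \<epsilon> by (simp add: algebra_simps)
  qed (use K in auto)
qed auto

lemma green_sum_0_angle: "green_sum l a 0 = of_real (\<Sum>m=1..l. cheb a m)"
  by (simp add: green_sum_def)

lemma cmod_green_sum_le:
  assumes "a \<ge> 2"
  shows "cmod (green_sum l a \<theta>) \<le> (\<Sum>m=1..l. cheb a m)"
proof -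
  have "cheb a m \<ge> 0" for m
    using cheb_ge_index[OF assms, of m] by simp
  then show ?thesis
    unfolding green_sum_def by (intro sum_norm_le) (simp add: norm_mult norm_power)
qed

text \<open>
  The first-order coefficient \<open>l (l + 1)\<close> of the theorem is twice the sum of \<open>1, \<dots>, l\<close>.
\<close>

lemma cheb_sum_le:
  "\<exists>K\<ge>0. \<forall>\<epsilon>\<in>{0..1}. 2 * (\<Sum>m=1..l. cheb (2 + 2 * \<epsilon>) m) \<le> real l * (real l + 1) + K * \<epsilon>"
proof -
  obtain K where K: "\<And>k. K k \<ge> 0"
    "\<And>k \<epsilon>. \<epsilon> \<in> {0..1} \<Longrightarrow> cheb (2 + 2 * \<epsilon>) k \<le> real k + K k * \<epsilon>"
    using cheb_le_index_plus by metis
  have gauss: "2 * (\<Sum>m=1..l. real m) = real l * (real l + 1)"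
    by (induction l) (auto simp: algebra_simps)
  show ?thesis
  proof (intro exI[of _ "2 * (\<Sum>m=1..l. K m)"] conjI ballI)
    fix \<epsilon> :: real assume "\<epsilon> \<in> {0..1}"
    then have "(\<Sum>m=1..l. cheb (2 + 2 * \<epsilon>) m) \<le> (\<Sum>m=1..l. real m + K m * \<epsilon>)"
      by (intro sum_mono K)
    also have "\<dots> = (\<Sum>m=1..l. real m) + (\<Sum>m=1..l. K m) * \<epsilon>"
      by (simp only: sum.distrib sum_distrib_right)
    finally show "2 * (\<Sum>m=1..l. cheb (2 + 2 * \<epsilon>) m) \<le> real l * (real l + 1) + 2 * (\<Sum>m=1..l. K m) * \<epsilon>"
      using gauss by linarith
  qed (auto intro!: sum_nonneg K)
qed

section \<open>Estimates over the high frequencies\<close>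

lemma cos_nonpos_between: 
  assumes "pi / 2 \<le> x" "x < 3 * pi / 2" shows "cos x \<le> 0"
proof -
  have "cos (x - pi) \<ge> 0"
    using assms by (intro cos_ge_zero) auto
  then show ?thesis by (simp add: cos_diff)
qed

text \<open>
  A high frequency has a nonpositive cosine in one direction. If it is the weakly coupled one,
  the term \<open>2 \<epsilon>\<close> is kept in full. If it is the strongly coupled one, the left-hand side is at
  least \<open>2\<close>, and this is where \<open>\<epsilon> \<le> 1\<close> enters.
\<close>

lemma high_frequency_ellipticity:
  assumes "\<omega> \<in> high_frequencies" "\<epsilon> \<in> {0..1}"
  shows "2 + 2 * \<epsilon> - 2 * cos (fst \<omega>) - 2 * \<epsilon> * cos (snd \<omega>) \<ge> 2 * \<epsilon>"
proof -
  have "\<epsilon> * cos (snd \<omega>) \<le> \<epsilon> * 1"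
    using assms by (intro mult_left_mono) auto
  moreover consider "cos (fst \<omega>) \<le> 0" | "cos (snd \<omega>) \<le> 0"
    using assms(1) cos_nonpos_between[of "fst \<omega>"] cos_nonpos_between[of "snd \<omega>"]
    by (fastforce simp: high_frequencies_def)
  then have "cos (fst \<omega>) \<le> 0 \<or> \<epsilon> * cos (snd \<omega>) \<le> 0"
    using assms(2) by cases (auto simp: mult_nonneg_nonpos)
  ultimately show ?thesis
    using assms(2) cos_le_one[of "fst \<omega>"] by (auto simp del: cos_le_one)
qed

text \<open>
  With \<open>n\<close> the squared modulus of the numerator and \<open>P = l (l + 1)\<close>, the norm identity bounds the
  squared modulus of the symbol by \<open>n / (n + 2 \<epsilon> P)\<close>. This is increasing in \<open>n\<close>, and
  \<open>n = 1 + O(\<epsilon>)\<close>.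
\<close>

lemma fd_symbol_upper:
  assumes "l \<ge> 1"
  shows "\<exists>M. \<forall>\<epsilon>\<in>{0<..1}. \<forall>\<omega>\<in>high_frequencies.
      cmod (schwarz_symbol l (fd_stencil \<epsilon>) \<omega>) \<le> 1 - real l * (real l + 1) * \<epsilon> + M * \<epsilon>\<^sup>2"
proof -
  define P where "P = real l * (real l + 1)"
  have P0: "P > 0"
    using assms by (simp add: P_def)
  obtain K where K: "K \<ge> 0"
    "\<And>\<epsilon>. \<epsilon> \<in> {0..1} \<Longrightarrow> 2 * (\<Sum>m=1..l. cheb (2 + 2 * \<epsilon>) m) \<le> P + K * \<epsilon>"
    using cheb_sum_le[of l] unfolding P_def by blast
  define H where "H = P + K"
  have H0: "H > 0" using P0 K by (simp add: H_def)
  define M where "M = 2 * H + H\<^sup>2 + 2 * P"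
  show ?thesis
  proof (intro exI[of _ "P * M"] ballI)
    fix \<epsilon> :: real and \<omega> :: "real \<times> real"
    assume \<epsilon>: "\<epsilon> \<in> {0<..1}" and \<omega>: "\<omega> \<in> high_frequencies"
    define a where "a = 2 + 2 * \<epsilon>"
    define n where "n = (cmod (symbol_num l a \<epsilon> \<omega>))\<^sup>2"
    define d where "d = (cmod (symbol_den l a \<epsilon> \<omega>))\<^sup>2"
    have a2: "a \<ge> 2" using \<epsilon> by (simp add: a_def)
    have uu: "P \<le> cheb a l * cheb a (Suc l)"
      unfolding P_def using cheb_ge_index[OF a2, of l] cheb_ge_index[OF a2, of "Suc l"]
      by (intro mult_mono) auto
    have "2 * \<epsilon> * P \<le> (a - 2 * cos (fst \<omega>) - 2 * \<epsilon> * cos (snd \<omega>)) * (cheb a l * cheb a (Suc l))"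
      using high_frequency_ellipticity[OF \<omega>, of \<epsilon>] \<epsilon> P0 unfolding a_def[symmetric]
      by (intro mult_mono uu) auto
    then have dn: "d \<ge> n + 2 * \<epsilon> * P"
      unfolding d_def n_def symbol_den_norm_identity by simp
    have n0: "n \<ge> 0" by (simp add: n_def)
    have eP: "\<epsilon> * P > 0" using \<epsilon> P0 by simp
    have den: "symbol_den l a \<epsilon> \<omega> \<noteq> 0"
      using dn n0 eP by (auto simp: d_def)
    have sym: "schwarz_symbol l (fd_stencil \<epsilon>) \<omega> = symbol_num l a \<epsilon> \<omega> / symbol_den l a \<epsilon> \<omega>"
      by (rule schwarz_symbol_nine_point[OF assms _ fd_stencil_def _ _ den]) (simp_all add: a_def)
    have "K * \<epsilon> \<le> K * 1"
      using K \<epsilon> by (intro mult_left_mono) auto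
    moreover have "2 * (\<Sum>m=1..l. cheb a m) \<le> P + K * \<epsilon>"
      unfolding a_def using \<epsilon> by (intro K) auto
    ultimately have hH: "cmod (green_sum l a (fst \<omega>)) \<le> H"
      using cmod_green_sum_le[OF a2, of l "fst \<omega>"] norm_ge_zero[of "green_sum l a (fst \<omega>)"]
      unfolding H_def by linarith
    have "cmod (symbol_num l a \<epsilon> \<omega>) \<le> 1 + cmod (of_real \<epsilon> * cis (snd \<omega>) * green_sum l a (fst \<omega>))"
      unfolding symbol_num_def by (rule norm_triangle_le) simp
    also have "\<dots> \<le> 1 + \<epsilon> * H"
      using hH \<epsilon> by (simp add: norm_mult)
    finally have "n \<le> (1 + \<epsilon> * H)\<^sup>2"
      unfolding n_def by (intro power_mono) auto
    also have "\<dots> = 1 + 2 * H * \<epsilon> + H\<^sup>2 * \<epsilon> * \<epsilon>"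
      by (simp add: power2_eq_square algebra_simps)
    also have "\<dots> \<le> 1 + 2 * H * \<epsilon> + H\<^sup>2 * \<epsilon> * 1"
      using \<epsilon> by (intro add_left_mono mult_left_mono) auto
    finally have nM: "n + 2 * \<epsilon> * P \<le> 1 + M * \<epsilon>"
      by (simp add: M_def algebra_simps)
    have "(1 - M * \<epsilon>) * (n + 2 * \<epsilon> * P) \<le> 1"
    proof (cases "1 - M * \<epsilon> \<ge> 0")
      case True
      then have "(1 - M * \<epsilon>) * (n + 2 * \<epsilon> * P) \<le> (1 - M * \<epsilon>) * (1 + M * \<epsilon>)"
        by (intro mult_left_mono nM)
      also have "(1 - x) * (1 + x) \<le> 1" for x :: real
        by (simp add: algebra_simps)
      finally show ?thesis .
    next
      case False
      then have "(1 - M * \<epsilon>) * (n + 2 * \<epsilon> * P) \<le> 0"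
        using n0 eP by (intro mult_nonpos_nonneg) auto
      then show ?thesis by simp
    qed
    then have "2 * (\<epsilon> * P) * ((1 - M * \<epsilon>) * (n + 2 * \<epsilon> * P)) \<le> 2 * (\<epsilon> * P) * 1"
      using eP by (intro mult_left_mono) auto
    then have key: "n \<le> (1 - 2 * (\<epsilon> * P) * (1 - M * \<epsilon>)) * (n + 2 * \<epsilon> * P)"
      by (simp add: algebra_simps)
    have "(cmod (schwarz_symbol l (fd_stencil \<epsilon>) \<omega>))\<^sup>2 = n / d"
      unfolding sym by (simp add: norm_divide power_divide n_def d_def)
    also have "\<dots> \<le> n / (n + 2 * \<epsilon> * P)"
      using dn n0 eP by (intro divide_left_mono mult_pos_pos) auto
    also have "\<dots> \<le> 1 - 2 * (\<epsilon> * P) * (1 - M * \<epsilon>)"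
      using key n0 eP by (subst pos_divide_le_eq) auto
    finally have sq: "(cmod (schwarz_symbol l (fd_stencil \<epsilon>) \<omega>))\<^sup>2 \<le> 1 - 2 * (\<epsilon> * P) * (1 - M * \<epsilon>)" .
    \<comment> \<open>Passing from the square to the modulus by \<open>2 x \<le> 1 + x\<^sup>2\<close> halves the first-order coefficient.\<close>
    have "0 \<le> (cmod (schwarz_symbol l (fd_stencil \<epsilon>) \<omega>) - 1)\<^sup>2"
      by simp
    then have "2 * cmod (schwarz_symbol l (fd_stencil \<epsilon>) \<omega>) \<le> 1 + (cmod (schwarz_symbol l (fd_stencil \<epsilon>) \<omega>))\<^sup>2"
      by (simp add: power2_diff)
    with sq show "cmod (schwarz_symbol l (fd_stencil \<epsilon>) \<omega>) \<le> 1 - real l * (real l + 1) * \<epsilon> + P * M * \<epsilon>\<^sup>2"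
      unfolding P_def[symmetric] by (simp add: algebra_simps power2_eq_square)
  qed
qed

text \<open>
  At \<open>(0, \<pi> / 2)\<close> the Green sum is a real number \<open>H\<close> and \<open>D = N + 2 \<eta> H\<close> with real part at least
  \<open>1\<close>, so \<open>|N| / |D| \<ge> 1 - 2 \<eta> H\<close>. The statement covers every stencil whose effective one-dimensional
  parameters on the line \<open>\<omega>\<^sub>1 = 0\<close> are those of finite differences with ratio \<open>\<eta>\<close>, so that it
  applies to both discretizations.
\<close>

lemma nine_point_symbol_lower:
  assumes "l \<ge> 1"
  shows "\<exists>M\<ge>0. \<forall>\<eta>\<in>{0..1}. \<forall>s_nw s_n s_w s_c. s_w \<noteq> 0 \<longrightarrow> - s_c / s_w = 2 + 2 * \<eta> \<longrightarrow>
      (s_n + 2 * s_nw) / s_w = \<eta> \<longrightarrow>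
      cmod (schwarz_symbol l (nine_point s_nw s_n s_w s_c) (0, pi / 2)) \<ge> 1 - real l * (real l + 1) * \<eta> - M * \<eta>\<^sup>2"
proof -
  obtain K where K: "K \<ge> 0"
    "\<And>\<epsilon>. \<epsilon> \<in> {0..1} \<Longrightarrow> 2 * (\<Sum>m=1..l. cheb (2 + 2 * \<epsilon>) m) \<le> real l * (real l + 1) + K * \<epsilon>"
    using cheb_sum_le[of l] by blast
  show ?thesis
  proof (intro exI[of _ K] conjI ballI allI impI)
    fix \<eta> s_nw s_n s_w s_c :: real
    assume \<eta>: "\<eta> \<in> {0..1}" and "s_w \<noteq> 0" and a: "- s_c / s_w = 2 + 2 * \<eta>"
      and \<tau>: "(s_n + 2 * s_nw) / s_w = \<eta>"
    define H where "H = (\<Sum>m=1..l. cheb (2 + 2 * \<eta>) m)"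
    have H0: "H \<ge> 0"
      unfolding H_def using cheb_ge_index[of "2 + 2 * \<eta>"] \<eta> 
      by (intro sum_nonneg) (auto intro: order_trans[OF of_nat_0_le_iff])
    define N where "N = symbol_num l (2 + 2 * \<eta>) \<eta> (0, pi / 2)"
    define D where "D = symbol_den l (2 + 2 * \<eta>) \<eta> (0, pi / 2)"
    have N: "N = 1 + of_real (\<eta> * H) * \<i>" and D: "D = N + of_real (2 * \<eta> * H)"
      unfolding N_def D_def symbol_num_def symbol_den_def fst_conv green_sum_0_angle H_def[symmetric]
      by (simp_all add: complex_eq_iff algebra_simps)
    have \<eta>H: "\<eta> * H \<ge> 0" using \<eta> H0 by simp
    have "Re D \<ge> 1" using \<eta>H by (simp add: N D mult.commute)
    then have D1: "cmod D \<ge> 1"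
      using complex_Re_le_cmod[of D] by linarith
    then have "D \<noteq> 0" by auto
    have sym: "schwarz_symbol l (nine_point s_nw s_n s_w s_c) (0, pi / 2) = N / D"
      unfolding N_def D_def
      by (rule schwarz_symbol_nine_point[OF assms \<open>s_w \<noteq> 0\<close> refl])
         (use a \<tau> \<open>D \<noteq> 0\<close> in \<open>simp_all add: D_def\<close>)
    have "cmod D \<le> cmod N + 2 * \<eta> * H"
      unfolding D using norm_triangle_ineq[of N "of_real (2 * \<eta> * H)"] \<eta>H by (simp del: of_real_mult)
    moreover have "2 * \<eta> * H * 1 \<le> 2 * \<eta> * H * cmod D"
      using \<eta>H D1 by (intro mult_left_mono) (auto simp: mult.commute)
    ultimately have "(1 - 2 * \<eta> * H) * cmod D \<le> cmod N"
      by (simp add: algebra_simps)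
    then have "1 - 2 * \<eta> * H \<le> cmod N / cmod D"
      using D1 by (subst pos_le_divide_eq) auto
    moreover have "\<eta> * (2 * H) \<le> \<eta> * (real l * (real l + 1) + K * \<eta>)"
      unfolding H_def using \<eta> by (intro mult_left_mono K) auto
    ultimately show "cmod (schwarz_symbol l (nine_point s_nw s_n s_w s_c) (0, pi / 2))
        \<ge> 1 - real l * (real l + 1) * \<eta> - K * \<eta>\<^sup>2"
      unfolding sym norm_divide by (simp add: algebra_simps power2_eq_square)
  qed (fact K(1))
qed

section \<open>The smoothing factors\<close>

lemma vertical_frequency_in_high_frequencies: "(0, pi / 2) \<in> high_frequencies"
  by (simp add: high_frequencies_def)

lemma smoothing_factor_ge:
  assumes "bdd_above ((\<lambda>\<omega>. cmod (schwarz_symbol l s \<omega>)) ` high_frequencies)"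
  shows "cmod (schwarz_symbol l s (0, pi / 2)) \<le> smoothing_factor l s"
  unfolding smoothing_factor_def by (rule cSUP_upper[OF vertical_frequency_in_high_frequencies assms])

text \<open>
  The high frequencies lie in a compact square, on which a continuous symbol is bounded.
\<close>

lemma bdd_above_continuous_symbol:
  assumes "continuous_on UNIV (schwarz_symbol l s)"
  shows "bdd_above ((\<lambda>\<omega>. cmod (schwarz_symbol l s \<omega>)) ` high_frequencies)"
proof -
  define B :: "(real \<times> real) set" where "B = {- pi / 2..3 * pi / 2} \<times> {- pi / 2..3 * pi / 2}"
  have "compact ((\<lambda>\<omega>. cmod (schwarz_symbol l s \<omega>)) ` B)"
    unfolding B_def
    by (intro compact_continuous_image compact_Times compact_Icc continuous_on_norm
        continuous_on_subset[OF assms]) auto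
  then have "bdd_above ((\<lambda>\<omega>. cmod (schwarz_symbol l s \<omega>)) ` B)"
    by (intro bounded_imp_bdd_above compact_imp_bounded)
  then show ?thesis
    by (rule bdd_above_mono) (auto simp: B_def high_frequencies_def)
qed

lemma fd_smoothing_factor_expansion:
  assumes "l \<ge> 1"
  shows "(\<lambda>\<epsilon>. smoothing_factor l (fd_stencil \<epsilon>) - (1 - real l * (real l + 1) * \<epsilon>)) \<in> O[at_right 0](\<lambda>\<epsilon>. \<epsilon>\<^sup>2)"
proof -
  define P where "P = real l * (real l + 1)"
  obtain M where M: "\<And>\<epsilon> \<omega>. \<epsilon> \<in> {0<..1} \<Longrightarrow> \<omega> \<in> high_frequencies \<Longrightarrow>
      cmod (schwarz_symbol l (fd_stencil \<epsilon>) \<omega>) \<le> 1 - P * \<epsilon> + M * \<epsilon>\<^sup>2"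
    using fd_symbol_upper[OF assms] unfolding P_def by blast
  obtain M' where M': "\<And>\<eta> s_nw s_n s_w s_c. \<eta> \<in> {0..1} \<Longrightarrow> s_w \<noteq> 0 \<Longrightarrow> - s_c / s_w = 2 + 2 * \<eta> \<Longrightarrow>
      (s_n + 2 * s_nw) / s_w = \<eta> \<Longrightarrow>
      cmod (schwarz_symbol l (nine_point s_nw s_n s_w s_c) (0, pi / 2)) \<ge> 1 - P * \<eta> - M' * \<eta>\<^sup>2"
    using nine_point_symbol_lower[OF assms] unfolding P_def by blast
  have "\<bar>smoothing_factor l (fd_stencil \<epsilon>) - (1 - P * \<epsilon>)\<bar> \<le> max M M' * \<epsilon>\<^sup>2" if \<epsilon>: "\<epsilon> \<in> {0<..<1}" for \<epsilon>
  proof -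
    have "smoothing_factor l (fd_stencil \<epsilon>) \<le> 1 - P * \<epsilon> + M * \<epsilon>\<^sup>2"
      unfolding smoothing_factor_def using vertical_frequency_in_high_frequencies \<epsilon> by (intro cSUP_least M) auto
    moreover have "cmod (schwarz_symbol l (fd_stencil \<epsilon>) (0, pi / 2)) \<le> smoothing_factor l (fd_stencil \<epsilon>)"
      using M[of \<epsilon>] \<epsilon> by (intro smoothing_factor_ge bdd_aboveI2[where M = "1 - P * \<epsilon> + M * \<epsilon>\<^sup>2"]) auto
    moreover have "cmod (schwarz_symbol l (fd_stencil \<epsilon>) (0, pi / 2)) \<ge> 1 - P * \<epsilon> - M' * \<epsilon>\<^sup>2"
      unfolding fd_stencil_def using \<epsilon> by (intro M') auto
    moreover have "M * \<epsilon>\<^sup>2 \<le> max M M' * \<epsilon>\<^sup>2" "M' * \<epsilon>\<^sup>2 \<le> max M M' * \<epsilon>\<^sup>2"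
      by (intro mult_right_mono; simp)+
    ultimately show ?thesis by linarith
  qed
  moreover have "eventually (\<lambda>\<epsilon>::real. \<epsilon> \<in> {0<..<1}) (at_right 0)"
    by (rule eventually_at_right_real) simp
  ultimately show ?thesis
    unfolding P_def[symmetric] by (intro bigoI[of _ "max M M'"]) (auto elim!: eventually_mono)
qed

text \<open>
  On \<open>\<omega>\<^sub>1 = 0\<close> the symbol is that of finite differences with the ratio \<open>\<eta> = 3 \<epsilon> / (2 - \<epsilon>)\<close>. The
  restriction to \<open>\<epsilon> \<le> 1 / 2\<close> keeps \<open>\<eta>\<close> within the range \<open>\<eta> \<le> 1\<close> of the lower bound.
\<close>

lemma fe_smoothing_factor_lower:
  assumes "l \<ge> 1"
    and smooth: "\<And>\<epsilon>. \<epsilon> \<in> {0..1} \<Longrightarrow> continuous_on UNIV (schwarz_symbol l (fe_stencil \<epsilon>))"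
  shows "\<exists>M. \<forall>\<epsilon>\<in>{0..1/2}. smoothing_factor l (fe_stencil \<epsilon>) \<ge> 1 - 3 / 2 * real l * (real l + 1) * \<epsilon> - M * \<epsilon>\<^sup>2"
proof -
  define P where "P = real l * (real l + 1)"
  have P0: "P \<ge> 0" by (simp add: P_def)
  obtain M where M0: "M \<ge> 0" and M: "\<And>\<eta> s_nw s_n s_w s_c. \<eta> \<in> {0..1} \<Longrightarrow> s_w \<noteq> 0 \<Longrightarrow> - s_c / s_w = 2 + 2 * \<eta> \<Longrightarrow>
      (s_n + 2 * s_nw) / s_w = \<eta> \<Longrightarrow>
      cmod (schwarz_symbol l (nine_point s_nw s_n s_w s_c) (0, pi / 2)) \<ge> 1 - P * \<eta> - M * \<eta>\<^sup>2"
    using nine_point_symbol_lower[OF assms(1)] unfolding P_def by blast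
  show ?thesis
  proof (intro exI[of _ "3 / 2 * P + 9 * M"] ballI)
    fix \<epsilon> :: real assume \<epsilon>: "\<epsilon> \<in> {0..1/2}"
    define \<eta> where "\<eta> = 3 * \<epsilon> / (2 - \<epsilon>)"
    have \<eta>: "\<eta> \<in> {0..1}" using \<epsilon> by (auto simp: \<eta>_def field_simps)
    have "3 * \<epsilon> \<le> (3 / 2 * \<epsilon> + 3 / 2 * \<epsilon>\<^sup>2) * (2 - \<epsilon>)"
    proof -
      have "(3 / 2 * \<epsilon> + 3 / 2 * \<epsilon>\<^sup>2) * (2 - \<epsilon>) = 3 * \<epsilon> + 3 / 2 * (\<epsilon> * \<epsilon> * (1 - \<epsilon>))"
        by (simp add: field_simps power2_eq_square)
      moreover have "0 \<le> \<epsilon> * \<epsilon> * (1 - \<epsilon>)" using \<epsilon> by auto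
      ultimately show ?thesis by linarith
    qed
    then have \<eta>_le: "\<eta> \<le> 3 / 2 * \<epsilon> + 3 / 2 * \<epsilon>\<^sup>2"
      using \<epsilon> by (simp add: \<eta>_def pos_divide_le_eq)
    have s_w: "- 2 / 3 + 1 / 3 * \<epsilon> = - ((2 - \<epsilon>) / 3)" and e2: "2 - \<epsilon> \<noteq> 0"
      using \<epsilon> by (auto simp: field_simps)
    have fe_data: "- 2 / 3 + 1 / 3 * \<epsilon> \<noteq> 0"
      "- (4 / 3 + 4 / 3 * \<epsilon>) / (- 2 / 3 + 1 / 3 * \<epsilon>) = 2 + 2 * \<eta>"
      "(1 / 3 - 2 / 3 * \<epsilon> + 2 * (- 1 / 6 - 1 / 6 * \<epsilon>)) / (- 2 / 3 + 1 / 3 * \<epsilon>) = \<eta>"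
      unfolding s_w \<eta>_def using e2 by (simp_all add: field_simps)
    have "\<epsilon> * 1 \<le> \<epsilon> * (2 - \<epsilon>)"
      using \<epsilon> by (intro mult_left_mono) auto
    then have "\<eta> \<le> 3 * \<epsilon>"
      using \<epsilon> by (simp add: \<eta>_def pos_divide_le_eq)
    then have "\<eta>\<^sup>2 \<le> (3 * \<epsilon>)\<^sup>2"
      using \<eta> by (intro power_mono) auto
    then have "M * \<eta>\<^sup>2 \<le> M * (9 * \<epsilon>\<^sup>2)"
      using M0 by (intro mult_left_mono) (auto simp: power_mult_distrib)
    moreover have "P * \<eta> \<le> P * (3 / 2 * \<epsilon> + 3 / 2 * \<epsilon>\<^sup>2)"
      using P0 \<eta>_le by (intro mult_left_mono)
    moreover have "1 - P * \<eta> - M * \<eta>\<^sup>2 \<le> cmod (schwarz_symbol l (fe_stencil \<epsilon>) (0, pi / 2))"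
      unfolding fe_stencil_def by (rule M[OF \<eta> fe_data])
    moreover have "cmod (schwarz_symbol l (fe_stencil \<epsilon>) (0, pi / 2)) \<le> smoothing_factor l (fe_stencil \<epsilon>)"
      using \<epsilon> by (intro smoothing_factor_ge bdd_above_continuous_symbol smooth) auto
    moreover have "3 / 2 * real l * (real l + 1) * \<epsilon> = 3 / 2 * (P * \<epsilon>)"
      by (simp add: P_def)
    moreover have "P * (3 / 2 * \<epsilon> + 3 / 2 * \<epsilon>\<^sup>2) = 3 / 2 * (P * \<epsilon>) + 3 / 2 * (P * \<epsilon>\<^sup>2)"
      "(3 / 2 * P + 9 * M) * \<epsilon>\<^sup>2 = 3 / 2 * (P * \<epsilon>\<^sup>2) + M * (9 * \<epsilon>\<^sup>2)"
      by (simp_all add: algebra_simps)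
    ultimately show "smoothing_factor l (fe_stencil \<epsilon>)
        \<ge> 1 - 3 / 2 * real l * (real l + 1) * \<epsilon> - (3 / 2 * P + 9 * M) * \<epsilon>\<^sup>2"
      by linarith
  qed
qed

theorem theorem3:
  fixes l :: nat
  assumes "l \<ge> 1"
    and fd_smooth: "\<And>\<epsilon>. \<epsilon> \<in> {0..1} \<Longrightarrow> Ck_smooth 2 (schwarz_symbol l (fd_stencil \<epsilon>))"
    and fe_smooth: "\<And>\<epsilon>. \<epsilon> \<in> {0..1} \<Longrightarrow> Ck_smooth 2 (schwarz_symbol l (fe_stencil \<epsilon>))"
  shows "(\<lambda>\<epsilon>. smoothing_factor l (fd_stencil \<epsilon>) - (1 - real l * (real l + 1) * \<epsilon>))
           \<in> O[at_right 0](\<lambda>\<epsilon>. \<epsilon>\<^sup>2)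
       \<and> (\<exists>R \<in> O[at_right 0](\<lambda>\<epsilon>. \<epsilon>\<^sup>2). \<forall>\<epsilon>\<in>{0..1}.
            smoothing_factor l (fe_stencil \<epsilon>) \<ge> 1 - 3 / 2 * real l * (real l + 1) * \<epsilon> + R \<epsilon>)"
proof
  show "(\<lambda>\<epsilon>. smoothing_factor l (fd_stencil \<epsilon>) - (1 - real l * (real l + 1) * \<epsilon>))
           \<in> O[at_right 0](\<lambda>\<epsilon>. \<epsilon>\<^sup>2)"
    by (rule fd_smoothing_factor_expansion[OF \<open>l \<ge> 1\<close>])
  let ?main = "\<lambda>\<epsilon>. 1 - 3 / 2 * real l * (real l + 1) * \<epsilon>"
  have "continuous_on UNIV (schwarz_symbol l (fe_stencil \<epsilon>))" if "\<epsilon> \<in> {0..1}" for \<epsilon>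
    using fe_smooth[OF that]
    by (auto simp: numeral_2_eq_2 intro!: continuous_at_imp_continuous_on differentiable_imp_continuous_within)
  from fe_smoothing_factor_lower[OF \<open>l \<ge> 1\<close> this] obtain M where
    M: "\<And>\<epsilon>. \<epsilon> \<in> {0..1/2} \<Longrightarrow> smoothing_factor l (fe_stencil \<epsilon>) \<ge> ?main \<epsilon> - M * \<epsilon>\<^sup>2"
    by blast
  \<comment> \<open>The order of \<open>R\<close> concerns \<open>\<epsilon>\<close> near \<open>0\<close> only; beyond \<open>1 / 2\<close> the remainder may be taken so
     that equality holds.\<close>
  define R where "R \<epsilon> = (if \<epsilon> \<le> 1/2 then - M * \<epsilon>\<^sup>2 else smoothing_factor l (fe_stencil \<epsilon>) - ?main \<epsilon>)" for \<epsilon>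
  have "eventually (\<lambda>\<epsilon>::real. \<epsilon> \<in> {0<..<1/2}) (at_right 0)"
    by (rule eventually_at_right_real) simp
  then have "R \<in> O[at_right 0](\<lambda>\<epsilon>. \<epsilon>\<^sup>2)"
    by (intro bigoI[of _ "\<bar>M\<bar>"]) (auto elim!: eventually_mono simp: R_def abs_mult)
  moreover have "\<forall>\<epsilon>\<in>{0..1}. smoothing_factor l (fe_stencil \<epsilon>) \<ge> ?main \<epsilon> + R \<epsilon>"
    using M by (auto simp: R_def)
  ultimately show "\<exists>R \<in> O[at_right 0](\<lambda>\<epsilon>. \<epsilon>\<^sup>2). \<forall>\<epsilon>\<in>{0..1}. smoothing_factor l (fe_stencil \<epsilon>) \<ge> ?main \<epsilon> + R \<epsilon>"
    by blast
qed

end
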